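(* Let $(W,S)$ be an affine Coxeter system with underlying finite Weyl group $W_0$ and let $\mathcal O\subseteq\Phi_0$ be a $W_0$-orbit. For all $k\in\mathbb N$ there is a poset isomorphism $$(\Sigma_{\mathcal O,k},\le)\cong(\Sigma_{\mathcal O},\le).$$ Moreover, all coverings in $\Sigma_{\mathcal O,k}$ are short.
   Context: Affine setting: $\Phi_0$ is a reduced irreducible crystallographic root system of a finite Weyl group $(W_0,S_0)$ in a Euclidean space $(V_0,B_0)$, with simple roots $\Delta_0=\{\alpha_s\mid s\in S_0\}$, positive roots $\Phi_0^+$ and highest root $\omega$. $V=V_0\oplus\mathbb R\delta$, and $B$ is the extension of $B_0$ to $V$ with radical $\mathbb R\delta$; $\|\alpha\|=\sqrt{B(\alpha,\alpha)}$. For $\beta$ with $B(\beta,\beta)\neq 0$, $s_\beta(v)=v-2\frac{B(v,\beta)}{B(\beta,\beta)}\beta$. $\Phi=\{\alpha+k\delta\mid\alpha\in\Phi_0,k\in\mathbb Z\}$, simple system $\Delta=\Delta_0\cup\{\delta-\omega\}$, $S=S_0\cup\{s_{\delta-\omega}\}$, $W=\langle S\rangle$ the affine Weyl group, with length function $\ell$; $\alpha_s$ denotes the simple root of $s\in S$. Positive roots: $\Phi^+=\{k\delta+\alpha,(k+1)\delta-\alpha\mid\alpha\in\Phi_0^+,k\in\mathbb N\}$, $\mathbb N=\{0,1,2,\dots\}$. Depth: $\operatorname{dp}(\beta)=\min\{\ell(w)\mid w\in W,w(\beta)\in\Delta\}$ for $\beta\in\Phi^+$. Root poset $(\Phi^+,\le)$: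 $\alpha\le\beta$ iff there is $w\in W$ with $w(\alpha)=\beta$ and $\ell(w)=\operatorname{dp}(\beta)-\operatorname{dp}(\alpha)$. Its covers are $\alpha\lhd s(\alpha)$ with $s\in S$, $\alpha\in\Phi^+\setminus\{\alpha_s\}$, $B(\alpha,\alpha_s)<0$. Such a cover is short if $-\|\alpha\|\|\alpha_s\|<B(\alpha,\alpha_s)<0$, and long otherwise. Subsets of $\Phi^+$ carry the induced order. For a $W_0$-orbit $\mathcal O\subseteq\Phi_0$, $\mathcal O^+=\mathcal O\cap\Phi_0^+$, $\Sigma_{\mathcal O,k}=\{k\delta+\alpha,\ (k+1)\delta-\alpha\mid\alpha\in\mathcal O^+\}$ and $\Sigma_{\mathcal O}=\Sigma_{\mathcal O,0}$. *)

theory Defs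
  imports "HOL-Analysis.Analysis"
begin

definition refl_by :: "('v::real_vector \<Rightarrow> 'v \<Rightarrow> real) \<Rightarrow> 'v \<Rightarrow> 'v \<Rightarrow> 'v" where
  "refl_by b \<beta> v = v - (2 * b v \<beta> / b \<beta> \<beta>) *\<^sub>R \<beta>"

definition word_prod :: "('v \<Rightarrow> 'v) list \<Rightarrow> 'v \<Rightarrow> 'v" where
  "word_prod ss = foldr (\<circ>) ss id"

text \<open>Only used for sets \<open>S\<close> of involutions, for which the set of products of
  elements of \<open>S\<close> is the group generated by \<open>S\<close>.\<close>

definition gen_group :: "('v \<Rightarrow> 'v) set \<Rightarrow> ('v \<Rightarrow> 'v) set" where
  "gen_group S = {word_prod ss | ss. set ss \<subseteq> S}"

definition word_length :: "('v \<Rightarrow> 'v) set \<Rightarrow> ('v \<Rightarrow> 'v) \<Rightarrow> nat" where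
  "word_length S w = (LEAST n. \<exists>ss. set ss \<subseteq> S \<and> word_prod ss = w \<and> length ss = n)"

text \<open>\<open>V\<^sub>0\<close> is an arbitrary Euclidean space and \<open>B\<^sub>0\<close> its inner product; the reflection
  \<open>s\<^sub>\<beta>\<close> of \<open>V\<^sub>0\<close> is \<open>refl_by (\<bullet>) \<beta>\<close>.\<close>

definition root_system :: "'a::euclidean_space set \<Rightarrow> bool" where
  "root_system \<Phi> \<longleftrightarrow> finite \<Phi> \<and> span \<Phi> = UNIV \<and> 0 \<notin> \<Phi> \<and>
     (\<forall>\<alpha>\<in>\<Phi>. refl_by (\<bullet>) \<alpha> ` \<Phi> = \<Phi>)"

definition crystallographic :: "'a::euclidean_space set \<Rightarrow> bool" where
  "crystallographic \<Phi> \<longleftrightarrow> (\<forall>\<alpha>\<in>\<Phi>. \<forall>\<beta>\<in>\<Phi>. 2 * (\<alpha> \<bullet> \<beta>) / (\<beta> \<bullet> \<beta>) \<in> \<int>)"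

definition reduced_roots :: "'a::euclidean_space set \<Rightarrow> bool" where
  "reduced_roots \<Phi> \<longleftrightarrow> (\<forall>\<alpha>\<in>\<Phi>. {c *\<^sub>R \<alpha> | c. c *\<^sub>R \<alpha> \<in> \<Phi>} = {\<alpha>, - \<alpha>})"

definition irreducible_roots :: "'a::euclidean_space set \<Rightarrow> bool" where
  "irreducible_roots \<Phi> \<longleftrightarrow> \<Phi> \<noteq> {} \<and>
     \<not> (\<exists>A B. A \<noteq> {} \<and> B \<noteq> {} \<and> A \<inter> B = {} \<and> A \<union> B = \<Phi> \<and> (\<forall>\<alpha>\<in>A. \<forall>\<beta>\<in>B. \<alpha> \<bullet> \<beta> = 0))"

definition nonneg_comb :: "'a::real_vector set \<Rightarrow> 'a \<Rightarrow> bool" where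
  "nonneg_comb \<Delta> v \<longleftrightarrow> (\<exists>c :: 'a \<Rightarrow> nat. v = (\<Sum>\<alpha>\<in>\<Delta>. real (c \<alpha>) *\<^sub>R \<alpha>))"

definition simple_system :: "'a::euclidean_space set \<Rightarrow> 'a set \<Rightarrow> bool" where
  "simple_system \<Phi> \<Delta> \<longleftrightarrow> \<Delta> \<subseteq> \<Phi> \<and> independent \<Delta> \<and> span \<Delta> = UNIV \<and>
     (\<forall>\<beta>\<in>\<Phi>. nonneg_comb \<Delta> \<beta> \<or> nonneg_comb \<Delta> (- \<beta>))"

definition pos_roots0 :: "'a::euclidean_space set \<Rightarrow> 'a set \<Rightarrow> 'a set" where
  "pos_roots0 \<Phi>0 \<Delta>0 = {\<beta> \<in> \<Phi>0. nonneg_comb \<Delta>0 \<beta>}"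

definition highest_root :: "'a::euclidean_space set \<Rightarrow> 'a set \<Rightarrow> 'a \<Rightarrow> bool" where
  "highest_root \<Phi>0 \<Delta>0 \<omega> \<longleftrightarrow> \<omega> \<in> \<Phi>0 \<and> (\<forall>\<alpha>\<in>\<Phi>0. nonneg_comb \<Delta>0 (\<omega> - \<alpha>))"

definition W0_orbit :: "'a::euclidean_space set \<Rightarrow> 'a set \<Rightarrow> 'a set \<Rightarrow> bool" where
  "W0_orbit \<Phi>0 \<Delta>0 \<O> \<longleftrightarrow>
     (\<exists>\<alpha>\<in>\<Phi>0. \<O> = (\<lambda>w. w \<alpha>) ` gen_group (refl_by (\<bullet>) ` \<Delta>0))"

text \<open>The space \<open>V = V\<^sub>0 \<oplus> \<real>\<delta>\<close> is \<open>'a \<times> real\<close>, the pair \<open>(v, a)\<close> standing for \<open>v + a\<delta>\<close>.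
  Its bilinear form is \<open>aff_form\<close>, with radical \<open>\<real>\<delta>\<close>; neither the inner product
  nor the norm of the product type is meant.\<close>

definition aff_form :: "'a::euclidean_space \<times> real \<Rightarrow> 'a \<times> real \<Rightarrow> real" where
  "aff_form u v = fst u \<bullet> fst v"

definition aff_norm :: "'a::euclidean_space \<times> real \<Rightarrow> real" where
  "aff_norm u = sqrt (aff_form u u)"

definition aff_simple :: "'a::euclidean_space set \<Rightarrow> 'a \<Rightarrow> ('a \<times> real) set" where
  "aff_simple \<Delta>0 \<omega> = {(\<alpha>, 0) | \<alpha>. \<alpha> \<in> \<Delta>0} \<union> {(- \<omega>, 1)}"

definition aff_gens :: "'a::euclidean_space set \<Rightarrow> 'a \<Rightarrow> ('a \<times> real \<Rightarrow> 'a \<times> real) set" where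
  "aff_gens \<Delta>0 \<omega> = refl_by aff_form ` aff_simple \<Delta>0 \<omega>"

definition aff_W :: "'a::euclidean_space set \<Rightarrow> 'a \<Rightarrow> ('a \<times> real \<Rightarrow> 'a \<times> real) set" where
  "aff_W \<Delta>0 \<omega> = gen_group (aff_gens \<Delta>0 \<omega>)"

definition aff_length :: "'a::euclidean_space set \<Rightarrow> 'a \<Rightarrow> ('a \<times> real \<Rightarrow> 'a \<times> real) \<Rightarrow> nat" where
  "aff_length \<Delta>0 \<omega> = word_length (aff_gens \<Delta>0 \<omega>)"

text \<open>For \<open>P = \<Phi>\<^sub>0\<^sup>+\<close> the following is the \<open>k\<close>-th layer of \<open>\<Phi>\<^sup>+\<close>, and for
  \<open>P = \<O> \<inter> \<Phi>\<^sub>0\<^sup>+\<close> it is \<open>\<Sigma>\<^bsub>\<O>,k\<^esub>\<close>.\<close>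

definition layer :: "'a::euclidean_space set \<Rightarrow> nat \<Rightarrow> ('a \<times> real) set" where
  "layer P k = {(\<alpha>, real k) | \<alpha>. \<alpha> \<in> P} \<union> {(- \<alpha>, real (k + 1)) | \<alpha>. \<alpha> \<in> P}"

definition aff_pos :: "'a::euclidean_space set \<Rightarrow> 'a set \<Rightarrow> ('a \<times> real) set" where
  "aff_pos \<Phi>0 \<Delta>0 = (\<Union>k. layer (pos_roots0 \<Phi>0 \<Delta>0) k)"

definition Sigma_orb :: "'a::euclidean_space set \<Rightarrow> 'a set \<Rightarrow> 'a set \<Rightarrow> nat \<Rightarrow> ('a \<times> real) set" where
  "Sigma_orb \<Phi>0 \<Delta>0 \<O> k = layer (\<O> \<inter> pos_roots0 \<Phi>0 \<Delta>0) k"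

definition depth :: "'a::euclidean_space set \<Rightarrow> 'a \<Rightarrow> 'a \<times> real \<Rightarrow> nat" where
  "depth \<Delta>0 \<omega> \<beta> =
     (LEAST n. \<exists>w\<in>aff_W \<Delta>0 \<omega>. w \<beta> \<in> aff_simple \<Delta>0 \<omega> \<and> aff_length \<Delta>0 \<omega> w = n)"

definition root_le ::
  "'a::euclidean_space set \<Rightarrow> 'a set \<Rightarrow> 'a \<Rightarrow> 'a \<times> real \<Rightarrow> 'a \<times> real \<Rightarrow> bool" where
  "root_le \<Phi>0 \<Delta>0 \<omega> \<alpha> \<beta> \<longleftrightarrow> \<alpha> \<in> aff_pos \<Phi>0 \<Delta>0 \<and> \<beta> \<in> aff_pos \<Phi>0 \<Delta>0 \<and>
     (\<exists>w\<in>aff_W \<Delta>0 \<omega>. w \<alpha> = \<beta> \<and>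
        int (aff_length \<Delta>0 \<omega> w) = int (depth \<Delta>0 \<omega> \<beta>) - int (depth \<Delta>0 \<omega> \<alpha>))"

definition poset_iso_on ::
  "('p \<Rightarrow> 'p \<Rightarrow> bool) \<Rightarrow> 'p set \<Rightarrow> ('q \<Rightarrow> 'q \<Rightarrow> bool) \<Rightarrow> 'q set \<Rightarrow> ('p \<Rightarrow> 'q) \<Rightarrow> bool" where
  "poset_iso_on le A le' A' f \<longleftrightarrow>
     bij_betw f A A' \<and> (\<forall>x\<in>A. \<forall>y\<in>A. le x y \<longleftrightarrow> le' (f x) (f y))"

definition covers_on :: "('p \<Rightarrow> 'p \<Rightarrow> bool) \<Rightarrow> 'p set \<Rightarrow> 'p \<Rightarrow> 'p \<Rightarrow> bool" where
  "covers_on le A x y \<longleftrightarrow> x \<in> A \<and> y \<in> A \<and> le x y \<and> x \<noteq> y \<and>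
     \<not> (\<exists>z\<in>A. z \<noteq> x \<and> z \<noteq> y \<and> le x z \<and> le z y)"

definition short_cover ::
  "'a::euclidean_space set \<Rightarrow> 'a set \<Rightarrow> 'a \<Rightarrow> 'a \<times> real \<Rightarrow> 'a \<times> real \<Rightarrow> bool" where
  "short_cover \<Phi>0 \<Delta>0 \<omega> \<alpha> \<beta> \<longleftrightarrow>
     covers_on (root_le \<Phi>0 \<Delta>0 \<omega>) (aff_pos \<Phi>0 \<Delta>0) \<alpha> \<beta> \<and>
     (\<exists>\<gamma>\<in>aff_simple \<Delta>0 \<omega>. \<alpha> \<noteq> \<gamma> \<and> \<beta> = refl_by aff_form \<gamma> \<alpha> \<and>
        - (aff_norm \<alpha> * aff_norm \<gamma>) < aff_form \<alpha> \<gamma> \<and> aff_form \<alpha> \<gamma> < 0)"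

end

(* The depth has a closed form on each orbit. For a root beta = a + m delta with q = (a,a), let
   L_q be the linear functional on V with value min(1, |alpha_s|^2/q) at each simple root alpha_s,
   and let lay(beta) be the index of the layer containing beta. Since the Cartan integers p, p' of
   two non-proportional roots are both zero or have min(|p|, |p'|) = 1, a simple reflection s
   changes L_q by -sgn B(beta, alpha_s) and preserves the layer, unless a is proportional to the
   finite part of alpha_s; in that case L_q changes by twice that amount and the layer by once that
   amount. Hence L_q - 1 - lay changes by exactly -sgn B(beta, alpha_s) in every case and vanishes
   on simple roots, so it is the depth. Translation by k delta commutes with W and shifts the depth
   by a constant on an orbit. Along a chain of covers the layer never decreases and it increases
   precisely at the long ones, so a chain inside one layer consists of short covers. *)

theory Submission
  imports Defs
begin

section \<open>Reflections and Cartan integers in an inner product space\<close>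

lemma refl_by_inner_self:
  fixes g :: "'a::real_inner"
  assumes "g \<noteq> 0"
  shows "refl_by (\<bullet>) g g = - g"
  using assms by (simp add: refl_by_def algebra_simps scaleR_2)

lemma inner_refl_by:
  fixes g :: "'a::real_inner"
  shows "refl_by (\<bullet>) g x \<bullet> refl_by (\<bullet>) g y = x \<bullet> y"
  by (cases "g = 0") (simp_all add: refl_by_def inner_diff_left inner_diff_right inner_commute field_simps)

text \<open>Linearity, involutivity and self-adjointness of the reflection in \<open>g\<close> let
  it be pulled out of the formula for the outer reflection. For \<open>g = 0\<close> it is the
  identity.\<close>

lemma refl_by_conj:
  fixes g :: "'a::real_inner"
  shows "refl_by (\<bullet>) (refl_by (\<bullet>) g \<rho>) x = refl_by (\<bullet>) g (refl_by (\<bullet>) \<rho> (refl_by (\<bullet>) g x))"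
proof (cases "g = 0")
  case False
  have invol: "refl_by (\<bullet>) g (refl_by (\<bullet>) g y) = y" for y
    using False by (simp add: refl_by_def inner_diff_left algebra_simps)
  have lin: "refl_by (\<bullet>) g (y - c *\<^sub>R z) = refl_by (\<bullet>) g y - c *\<^sub>R refl_by (\<bullet>) g z" for y z c
    by (simp add: refl_by_def inner_diff_left algebra_simps add_divide_distrib diff_divide_distrib)
  have adj: "x \<bullet> refl_by (\<bullet>) g \<rho> = refl_by (\<bullet>) g x \<bullet> \<rho>"
    using inner_refl_by[of g "refl_by (\<bullet>) g x" \<rho>] invol by simp
  show ?thesis
    unfolding refl_by_def[of _ "refl_by (\<bullet>) g \<rho>"] refl_by_def[of _ \<rho>] lin invol adj inner_refl_by ..
qed (simp add: refl_by_def)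

text \<open>Strict Cauchy-Schwarz: the component of \<open>a\<close> orthogonal to \<open>b\<close>
  is nonzero, so its square norm is positive.\<close>

lemma inner_square_less:
  fixes a b :: "'a::real_inner"
  assumes "b \<noteq> 0" and "\<And>c. a \<noteq> c *\<^sub>R b"
  shows "(a \<bullet> b)\<^sup>2 < (a \<bullet> a) * (b \<bullet> b)"
proof -
  let ?u = "a - ((a \<bullet> b) / (b \<bullet> b)) *\<^sub>R b"
  have "?u \<noteq> 0" using assms(2) by auto
  hence "0 < ?u \<bullet> ?u" by simp
  also have "?u \<bullet> ?u = a \<bullet> a - (a \<bullet> b)\<^sup>2 / (b \<bullet> b)"
    using assms(1) by (simp add: inner_diff_left inner_diff_right inner_commute power2_eq_square field_simps)
  finally show ?thesis using assms(1) by (simp add: field_simps)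
qed

text \<open>The pairing of \<open>a\<close> with the coroot of \<open>b\<close>; it is linear in the
  first argument only.\<close>

definition cartan :: "'a::real_inner \<Rightarrow> 'a \<Rightarrow> real" where
  "cartan a b = 2 * (a \<bullet> b) / (b \<bullet> b)"

text \<open>By strict Cauchy-Schwarz the product of the two Cartan integers is below 4, so if they
  are nonzero one of them is 1 or -1. Their quotient is the ratio of the square norms: the
  \<open>min\<close> factor is 1 if \<open>cartan a b\<close> is the one of absolute value 1, and
  otherwise it turns \<open>cartan a b\<close> into \<open>cartan b a\<close>.\<close>

lemma cartan_min_weight:
  fixes a b :: "'a::real_inner"
  assumes ne: "a \<noteq> 0" "b \<noteq> 0" and np: "\<And>c. a \<noteq> c *\<^sub>R b"
    and int: "cartan a b \<in> \<int>" "cartan b a \<in> \<int>"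
  shows "cartan a b * min 1 ((b \<bullet> b) / (a \<bullet> a)) = sgn (a \<bullet> b)"
proof (cases "a \<bullet> b = 0")
  case False
  have pa: "a \<bullet> a > 0" and pb: "b \<bullet> b > 0" using ne by auto
  obtain i j where i: "cartan a b = of_int i" and j: "cartan b a = of_int j"
    using int by (auto elim!: Ints_cases)
  have "cartan a b * cartan b a = 4 * ((a \<bullet> b)\<^sup>2 / ((a \<bullet> a) * (b \<bullet> b)))"
    by (simp add: cartan_def inner_commute power2_eq_square)
  also have "\<dots> < 4" using inner_square_less[OF ne(2) np] pa pb by (simp add: field_simps)
  finally have "of_int (i * j) < (4::real)" using i j by simp
  hence ij: "\<bar>i\<bar> * \<bar>j\<bar> < 4"
  proof -
    have "0 \<le> cartan a b * cartan b a" by (simp add: cartan_def inner_commute)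
    hence "0 \<le> i * j" using i j by (metis of_int_mult of_int_0_le_iff)
    moreover have "i * j < 4" using \<open>of_int (i * j) < (4::real)\<close> by linarith
    ultimately show ?thesis by (simp flip: abs_mult)
  qed
  have inz: "i \<noteq> 0" "j \<noteq> 0"
    using i j False ne by (auto simp: cartan_def inner_commute)
  have rel: "cartan a b * (b \<bullet> b) = 2 * (a \<bullet> b)" "cartan b a * (a \<bullet> a) = 2 * (a \<bullet> b)"
    using ne by (simp_all add: cartan_def inner_commute)
  have absrel: "\<bar>of_int i\<bar> * (b \<bullet> b) = \<bar>of_int j\<bar> * (a \<bullet> a)"
    using rel i j by (metis abs_mult abs_of_pos pa pb)
  have sg: "sgn (a \<bullet> b) = sgn (of_int i)" "sgn (a \<bullet> b) = sgn (of_int j :: real)"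
  proof -
    show "sgn (a \<bullet> b) = sgn (of_int i)"
      using arg_cong[OF rel(1), of sgn] i pb by (simp add: sgn_mult)
    show "sgn (a \<bullet> b) = sgn (of_int j :: real)"
      using arg_cong[OF rel(2), of sgn] j pa by (simp add: sgn_mult)
  qed
  have "\<bar>i\<bar> = 1 \<or> \<bar>j\<bar> = 1"
  proof (rule ccontr)
    assume "\<not> ?thesis"
    hence "\<bar>i\<bar> \<ge> 2" "\<bar>j\<bar> \<ge> 2" using inz by auto
    hence "2 * 2 \<le> \<bar>i\<bar> * \<bar>j\<bar>" by (intro mult_mono) auto
    thus False using ij by simp
  qed
  thus ?thesis
  proof
    assume 1: "\<bar>i\<bar> = 1"
    hence "\<bar>of_int i :: real\<bar> = 1" by linarith
    moreover have "1 \<le> \<bar>of_int j :: real\<bar>" using inz(2) by linarith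
    ultimately have "a \<bullet> a \<le> b \<bullet> b"
      using absrel mult_right_mono[of 1 "\<bar>of_int j\<bar>" "a \<bullet> a"] pa by simp
    hence "min 1 ((b \<bullet> b) / (a \<bullet> a)) = 1" using pa by (simp add: field_simps)
    moreover have "of_int i = sgn (of_int i :: real)" using 1 by (auto simp: abs_if split: if_splits)
    ultimately show ?thesis using i sg by simp
  next
    assume 1: "\<bar>j\<bar> = 1"
    hence "\<bar>of_int j :: real\<bar> = 1" by linarith
    moreover have "1 \<le> \<bar>of_int i :: real\<bar>" using inz(1) by linarith
    ultimately have "b \<bullet> b \<le> a \<bullet> a"
      using absrel mult_right_mono[of 1 "\<bar>of_int i\<bar>" "b \<bullet> b"] pb by simp
    hence "min 1 ((b \<bullet> b) / (a \<bullet> a)) = (b \<bullet> b) / (a \<bullet> a)" using pa by (simp add: field_simps)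
    hence "cartan a b * min 1 ((b \<bullet> b) / (a \<bullet> a)) = cartan b a"
      using ne by (simp add: cartan_def inner_commute)
    moreover have "of_int j = sgn (of_int j :: real)" using 1 by (auto simp: abs_if split: if_splits)
    ultimately show ?thesis using j sg by simp
  qed
qed (simp add: cartan_def)

section \<open>Words and reduced words\<close>

lemma word_prod_simps [simp]:
  "word_prod [] = id" "word_prod (s # ss) = s \<circ> word_prod ss"
  by (simp_all add: word_prod_def)

lemma word_prod_append: "word_prod (ss @ ts) = word_prod ss \<circ> word_prod ts"
  by (induction ss) (simp_all add: comp_assoc)

lemma reduced_word_exists:
  assumes "w \<in> gen_group S"
  obtains ss where "set ss \<subseteq> S" "word_prod ss = w" "length ss = word_length S w"
proof -
  have "\<exists>n ss. set ss \<subseteq> S \<and> word_prod ss = w \<and> length ss = n"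
    using assms by (auto simp: gen_group_def)
  from LeastI_ex[OF this] show thesis using that by (auto simp: word_length_def)
qed

lemma word_length_le:
  assumes "set ss \<subseteq> S" "word_prod ss = w"
  shows "word_length S w \<le> length ss"
  unfolding word_length_def using assms by (intro Least_le) blast

section \<open>Finite root systems: coordinates, positivity and simple reflections\<close>

locale simple_roots =
  fixes \<Phi> \<Delta> :: "'a::euclidean_space set"
  assumes rs: "root_system \<Phi>" and cryst: "crystallographic \<Phi>" and red: "reduced_roots \<Phi>"
    and simple: "simple_system \<Phi> \<Delta>"
begin

text \<open>Also applied to vectors that are not roots, such as \<open>\<omega> - a\<close>, where
  it compares two roots coefficientwise.\<close>

abbreviation pos :: "'a \<Rightarrow> bool" where "pos \<equiv> nonneg_comb \<Delta>"

abbreviation coef :: "'a \<Rightarrow> 'a \<Rightarrow> real" where "coef \<equiv> representation \<Delta>"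

lemma simple_in_roots: "g \<in> \<Delta> \<Longrightarrow> g \<in> \<Phi>"
  using simple by (auto simp: simple_system_def)

lemma finite_simple: "finite \<Delta>"
  using simple rs by (auto simp: simple_system_def root_system_def intro: finite_subset)

lemma indep: "independent \<Delta>" and spn: "v \<in> span \<Delta>"
  using simple by (auto simp: simple_system_def)

lemma root_nonzero: "a \<in> \<Phi> \<Longrightarrow> a \<noteq> 0"
  using rs by (auto simp: root_system_def)

lemma refl_root: "a \<in> \<Phi> \<Longrightarrow> g \<in> \<Phi> \<Longrightarrow> refl_by (\<bullet>) g a \<in> \<Phi>"
  using rs by (auto simp: root_system_def)

lemma neg_root: "a \<in> \<Phi> \<Longrightarrow> - a \<in> \<Phi>"
  using refl_root[of a a] refl_by_inner_self[OF root_nonzero] by metis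

lemma root_scaleR: "a \<in> \<Phi> \<Longrightarrow> b \<in> \<Phi> \<Longrightarrow> a = c *\<^sub>R b \<Longrightarrow> a = b \<or> a = - b"
  using red unfolding reduced_roots_def by blast

lemma cartan_Ints: "a \<in> \<Phi> \<Longrightarrow> b \<in> \<Phi> \<Longrightarrow> cartan a b \<in> \<int>"
  using cryst by (auto simp: crystallographic_def cartan_def)

lemma refl_cartan: "refl_by (\<bullet>) g a = a - cartan a g *\<^sub>R g"
  by (simp add: refl_by_def cartan_def)

lemma coef_sum: "(\<Sum>g\<in>\<Delta>. coef v g *\<^sub>R g) = v"
  by (rule real_vector.sum_representation_eq[OF indep spn finite_simple]) simp

lemma coef_add: "coef (u + v) g = coef u g + coef v g"
  using real_vector.representation_add[OF indep spn spn] by metis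

lemma coef_diff: "coef (u - v) g = coef u g - coef v g"
  using real_vector.representation_diff[OF indep spn spn] by metis

lemma coef_minus: "coef (- v) g = - coef v g"
  using real_vector.representation_neg[OF indep spn] by metis

lemma coef_scaleR: "coef (c *\<^sub>R v) g = c * coef v g"
  using real_vector.representation_scale[OF indep spn] by metis

lemma coef_simple: "h \<in> \<Delta> \<Longrightarrow> coef h g = (if g = h then 1 else 0)"
  using real_vector.representation_basis[OF indep] by auto

lemma pos_iff: "pos v \<longleftrightarrow> (\<forall>g\<in>\<Delta>. coef v g \<in> \<nat>)"
proof
  assume "pos v"
  then obtain c :: "'a \<Rightarrow> nat" where c: "v = (\<Sum>g\<in>\<Delta>. real (c g) *\<^sub>R g)"
    by (auto simp: nonneg_comb_def)
  show "\<forall>g\<in>\<Delta>. coef v g \<in> \<nat>"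
  proof
    fix h assume h: "h \<in> \<Delta>"
    have "coef v h = (\<Sum>g\<in>\<Delta>. coef (real (c g) *\<^sub>R g) h)"
      unfolding c by (subst real_vector.representation_sum[OF indep]) (auto simp: spn)
    also have "\<dots> = (\<Sum>g\<in>\<Delta>. if h = g then real (c g) else 0)"
      by (intro sum.cong) (auto simp: coef_scaleR coef_simple)
    also have "\<dots> = real (c h)" using h finite_simple by simp
    finally show "coef v h \<in> \<nat>" by simp
  qed
next
  assume v: "\<forall>g\<in>\<Delta>. coef v g \<in> \<nat>"
  hence "v = (\<Sum>g\<in>\<Delta>. real (nat \<lfloor>coef v g\<rfloor>) *\<^sub>R g)"
    by (subst coef_sum[of v, symmetric], intro sum.cong) (auto elim!: Nats_cases)
  thus "pos v" unfolding nonneg_comb_def by (rule exI[where x = "\<lambda>g. nat \<lfloor>coef v g\<rfloor>"])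
qed

lemma pos_add: "pos u \<Longrightarrow> pos v \<Longrightarrow> pos (u + v)"
  by (auto simp: pos_iff coef_add)

lemma pos_scaleR: "pos v \<Longrightarrow> pos (real n *\<^sub>R v)"
  by (auto simp: pos_iff coef_scaleR)

lemma pos_coef_nonneg: "pos v \<Longrightarrow> g \<in> \<Delta> \<Longrightarrow> coef v g \<ge> 0"
  by (auto simp: pos_iff elim!: Nats_cases)

lemma pos_antisym:
  assumes "pos v" "pos (- v)"
  shows "v = 0"
proof -
  have "coef v g = 0" if "g \<in> \<Delta>" for g
    using pos_coef_nonneg[OF assms(1) that] pos_coef_nonneg[OF assms(2) that] by (simp add: coef_minus)
  thus ?thesis using coef_sum[of v] by simp
qed

lemma pos_or_neg: "a \<in> \<Phi> \<Longrightarrow> pos a \<or> pos (- a)"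
  using simple by (auto simp: simple_system_def)

lemma pos_minus_iff: "a \<in> \<Phi> \<Longrightarrow> pos (- a) \<longleftrightarrow> \<not> pos a"
  using pos_or_neg pos_antisym root_nonzero by blast

lemma pos_simple: "g \<in> \<Delta> \<Longrightarrow> pos g"
  by (simp add: pos_iff coef_simple)

text \<open>Since the system is reduced, a positive root other than \<open>g\<close> has a positive
  coordinate outside \<open>g\<close>. The reflection changes only the \<open>g\<close>-coordinate,
  and one positive coordinate decides the sign of a root.\<close>

lemma pos_refl_simple:
  assumes "a \<in> \<Phi>" "g \<in> \<Delta>" "pos a" "a \<noteq> g"
  shows "pos (refl_by (\<bullet>) g a)"
proof -
  have "\<exists>h\<in>\<Delta>. h \<noteq> g \<and> coef a h \<noteq> 0"
  proof (rule ccontr)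
    assume "\<not> ?thesis"
    hence "(\<Sum>h\<in>\<Delta>. coef a h *\<^sub>R h) = (\<Sum>h\<in>{g}. coef a h *\<^sub>R h)"
      using finite_simple assms(2) by (intro sum.mono_neutral_right) auto
    hence eq: "a = coef a g *\<^sub>R g" using coef_sum[of a] by simp
    from root_scaleR[OF assms(1) simple_in_roots[OF assms(2)] eq] assms(4) have "a = - g" by simp
    hence "coef a g = - 1" using assms(2) by (simp add: coef_minus coef_simple)
    thus False using pos_coef_nonneg[OF assms(3,2)] by simp
  qed
  then obtain h where h: "h \<in> \<Delta>" "h \<noteq> g" "coef a h \<noteq> 0" by blast
  have "coef (refl_by (\<bullet>) g a) h = coef a h"
    using h assms(2) by (simp add: refl_cartan coef_diff coef_scaleR coef_simple)
  moreover have "coef a h > 0" using pos_coef_nonneg[OF assms(3) h(1)] h(3) by simp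
  ultimately have "\<not> pos (- refl_by (\<bullet>) g a)"
    using pos_coef_nonneg[OF _ h(1)] by (fastforce simp: coef_minus)
  thus ?thesis using pos_or_neg refl_root[OF assms(1) simple_in_roots[OF assms(2)]] by blast
qed

lemma exists_simple_inner_pos:
  assumes "pos v" "u \<bullet> v > 0"
  obtains g where "g \<in> \<Delta>" "u \<bullet> g > 0"
proof -
  have "\<exists>g\<in>\<Delta>. u \<bullet> g > 0"
  proof (rule ccontr)
    assume "\<not> ?thesis"
    hence "(\<Sum>g\<in>\<Delta>. coef v g * (u \<bullet> g)) \<le> 0"
      using pos_coef_nonneg[OF assms(1)] by (intro sum_nonpos mult_nonneg_nonpos) (auto simp: not_less)
    also have "(\<Sum>g\<in>\<Delta>. coef v g * (u \<bullet> g)) = u \<bullet> v"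
      by (subst (2) coef_sum[of v, symmetric]) (simp add: inner_sum_right)
    finally show False using assms(2) by simp
  qed
  thus thesis using that by blast
qed

lemma cartan_ge_1:
  assumes "a \<in> \<Phi>" "b \<in> \<Phi>" "a \<bullet> b > 0"
  shows "cartan a b \<ge> 1"
proof -
  have "cartan a b > 0" using assms root_nonzero by (simp add: cartan_def)
  thus ?thesis using cartan_Ints[OF assms(1,2)] by (auto elim!: Ints_cases)
qed

text \<open>Induction on the height of \<rho>: a simple \<open>g\<close> with
  \<open>\<rho> \<bullet> g > 0\<close> reflects \<rho> to a positive root of smaller height, whose
  reflection is conjugate under \<open>g\<close> to that of \<rho>. This makes orbits stable under
  the reflections in \<omega> and in their own members.\<close>

lemma closed_under_pos_refl:
  assumes X: "\<And>g x. g \<in> \<Delta> \<Longrightarrow> x \<in> X \<Longrightarrow> refl_by (\<bullet>) g x \<in> X"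
    and "\<rho> \<in> \<Phi>" "pos \<rho>" "x \<in> X"
  shows "refl_by (\<bullet>) \<rho> x \<in> X"
  using assms(2-)
proof (induction "nat \<lfloor>\<Sum>g\<in>\<Delta>. coef \<rho> g\<rfloor>" arbitrary: \<rho> x rule: less_induct)
  case less
  show ?case
  proof (cases "\<rho> \<in> \<Delta>")
    case False
    have "\<rho> \<bullet> \<rho> > 0" using root_nonzero less.prems by simp
    then obtain g where g: "g \<in> \<Delta>" "\<rho> \<bullet> g > 0"
      using exists_simple_inner_pos less.prems by metis
    let ?r = "refl_by (\<bullet>) g \<rho>"
    have r: "?r \<in> \<Phi>" "pos ?r"
      using refl_root[OF less.prems(1) simple_in_roots[OF g(1)]]
        pos_refl_simple[OF less.prems(1) g(1) less.prems(2)] g(1) False by auto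
    have "(\<Sum>h\<in>\<Delta>. coef ?r h) = (\<Sum>h\<in>\<Delta>. coef \<rho> h) - cartan \<rho> g * (\<Sum>h\<in>\<Delta>. coef g h)"
      by (simp add: refl_cartan coef_diff coef_scaleR sum_subtractf sum_distrib_left)
    also have "(\<Sum>h\<in>\<Delta>. coef g h) = 1"
      using g(1) finite_simple by (simp add: coef_simple)
    finally have "(\<Sum>h\<in>\<Delta>. coef ?r h) \<le> (\<Sum>h\<in>\<Delta>. coef \<rho> h) - 1"
      using cartan_ge_1[OF less.prems(1) simple_in_roots[OF g(1)] g(2)] by simp
    \<comment> \<open>Nonnegativity keeps the truncation by \<open>nat\<close> from hiding the drop
      in height.\<close>
    moreover have "0 \<le> (\<Sum>h\<in>\<Delta>. coef ?r h)" using pos_coef_nonneg[OF r(2)] by (intro sum_nonneg)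
    ultimately have "nat \<lfloor>\<Sum>h\<in>\<Delta>. coef ?r h\<rfloor> < nat \<lfloor>\<Sum>h\<in>\<Delta>. coef \<rho> h\<rfloor>" by linarith
    hence "refl_by (\<bullet>) g (refl_by (\<bullet>) ?r (refl_by (\<bullet>) g x)) \<in> X"
      using less.hyps r X g(1) less.prems(3) by blast
    moreover have "refl_by (\<bullet>) g ?r = \<rho>"
      using root_nonzero[OF simple_in_roots[OF g(1)]]
      by (simp add: refl_by_def inner_diff_left algebra_simps)
    ultimately show ?thesis using refl_by_conj[of g ?r x] by simp
  qed (use X less.prems in blast)
qed

end

section \<open>Affine roots: the highest root, and how simple reflections move the layers\<close>

locale affine_roots = simple_roots +
  fixes \<omega> :: 'a
  assumes highest: "highest_root \<Phi> \<Delta> \<omega>"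
begin

abbreviation "srefl \<equiv> refl_by aff_form"

abbreviation "SS \<equiv> aff_simple \<Delta> \<omega>"

abbreviation "le \<equiv> root_le \<Phi> \<Delta> \<omega>"

text \<open>Roots of both signs are kept, because this set is stable under all simple reflections
  while each simple root is sent to a negative one. Words can thus be applied without tracking
  signs.\<close>

definition aroots :: "('a \<times> real) set" where "aroots = \<Phi> \<times> \<int>"

text \<open>Layer k consists of a + k\<delta> and -a + (k+1)\<delta> with a positive, hence the
  correction by 1 for a negative finite part. Negative affine roots get negative values, so
  positivity becomes \<open>lay \<beta> \<ge> 0\<close>.\<close>

definition lay :: "'a \<times> real \<Rightarrow> real" where
  "lay \<beta> = snd \<beta> - (if pos (fst \<beta>) then 0 else 1)"

lemma omega_root: "\<omega> \<in> \<Phi>" and omega_diff_pos: "a \<in> \<Phi> \<Longrightarrow> pos (\<omega> - a)"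
  using highest by (auto simp: highest_root_def)

lemma omega_pos: "pos \<omega>"
proof (rule ccontr)
  assume "\<not> pos \<omega>"
  hence "pos (- \<omega>)" using pos_or_neg omega_root by blast
  \<comment> \<open>Here \<omega> is split as 2\<omega> + (-\<omega>), where 2\<omega> is the
    difference of the highest root and the root -\<omega>.\<close>
  hence "pos ((\<omega> - (- \<omega>)) + (- \<omega>))" using omega_diff_pos neg_root omega_root pos_add by blast
  thus False using \<open>\<not> pos \<omega>\<close> by simp
qed

text \<open>Maximality makes the difference of \<omega> and its image under a simple reflection a
  nonnegative multiple of that simple root, so the Cartan integer is nonnegative.\<close>

lemma omega_dominant:
  assumes "pos v"
  shows "\<omega> \<bullet> v \<ge> 0"
proof -
  have "\<omega> \<bullet> g \<ge> 0" if g: "g \<in> \<Delta>" for g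
  proof -
    have "\<omega> - refl_by (\<bullet>) g \<omega> = cartan \<omega> g *\<^sub>R g" by (simp add: refl_cartan)
    hence "pos (cartan \<omega> g *\<^sub>R g)"
      using omega_diff_pos[OF refl_root[OF omega_root simple_in_roots[OF g]]] by simp
    from pos_coef_nonneg[OF this g] have "cartan \<omega> g \<ge> 0" using g by (simp add: coef_scaleR coef_simple)
    moreover have "g \<bullet> g > 0" using root_nonzero[OF simple_in_roots[OF g]] by simp
    ultimately show ?thesis by (simp add: cartan_def zero_le_divide_iff)
  qed
  hence "0 \<le> (\<Sum>g\<in>\<Delta>. coef v g * (\<omega> \<bullet> g))"
    using pos_coef_nonneg[OF assms] by (intro sum_nonneg mult_nonneg_nonneg) auto
  also have "\<dots> = \<omega> \<bullet> v"
    by (subst (2) coef_sum[of v, symmetric]) (simp add: inner_sum_right)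
  finally show ?thesis .
qed

text \<open>Let n be the Cartan integer, nonnegative by dominance. If n > 0, the negative n\<omega>
  - a of the reflected root is positive. If n \<ge> 2, comparing both \<open>a\<close> and n\<omega>
  - a with the highest root bounds \<open>a\<close> by (n - 1)\<omega> from both sides; the
  resulting equality is excluded by reducedness and positivity.\<close>

lemma cartan_omega:
  assumes "a \<in> \<Phi>" "pos a" "a \<noteq> \<omega>"
  shows "cartan a \<omega> = 0 \<or> cartan a \<omega> = 1 \<and> \<not> pos (refl_by (\<bullet>) \<omega> a)"
proof -
  obtain i where i: "cartan a \<omega> = of_int i"
    using cartan_Ints[OF assms(1) omega_root] by (auto elim!: Ints_cases)
  have "cartan a \<omega> \<ge> 0" using omega_dominant[OF assms(2)] by (simp add: cartan_def inner_commute)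
  hence "i \<ge> 0" using i by simp
  then obtain n where n: "cartan a \<omega> = real n" using i by (metis of_int_of_nat_eq zero_le_imp_eq_int)
  let ?r = "refl_by (\<bullet>) \<omega> a"
  have r: "?r = a - real n *\<^sub>R \<omega>" by (simp add: refl_cartan n)
  have ra: "?r \<in> \<Phi>" using refl_root assms(1) omega_root by blast
  show ?thesis
  proof (cases "n = 0")
    case False
    have "- ?r = (\<omega> - a) + real (n - 1) *\<^sub>R \<omega>"
      using False by (simp add: r algebra_simps of_nat_diff)
    hence "pos (- ?r)" using omega_diff_pos[OF assms(1)] pos_add pos_scaleR omega_pos by metis
    moreover have "n = 1"
    proof (rule ccontr)
      assume "n \<noteq> 1"
      with False have n2: "n \<ge> 2" by simp
      have "(\<omega> - a) + real (n - 2) *\<^sub>R \<omega> = real (n - 1) *\<^sub>R \<omega> - a"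
        using n2 by (simp add: algebra_simps of_nat_diff scaleR_2)
      hence 1: "pos (real (n - 1) *\<^sub>R \<omega> - a)"
        using omega_diff_pos[OF assms(1)] pos_add pos_scaleR omega_pos by metis
      have "\<omega> - (- ?r) = - (real (n - 1) *\<^sub>R \<omega> - a)"
        using n2 by (simp add: r algebra_simps of_nat_diff)
      hence "pos (- (real (n - 1) *\<^sub>R \<omega> - a))" using omega_diff_pos[OF neg_root[OF ra]] by simp
      from pos_antisym[OF 1 this] have "a = real (n - 1) *\<^sub>R \<omega>" by simp
      from root_scaleR[OF assms(1) omega_root this] assms(3) have "a = - \<omega>" by simp
      thus False using pos_antisym[OF omega_pos] assms(2) root_nonzero[OF omega_root] by simp
    qed
    ultimately show ?thesis using n pos_minus_iff[OF ra] by simp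
  qed (simp add: n)
qed

lemma srefl_eq:
  fixes \<beta> \<gamma> :: "'a \<times> real"
  shows "srefl \<gamma> \<beta> = (refl_by (\<bullet>) (fst \<gamma>) (fst \<beta>), snd \<beta> - cartan (fst \<beta>) (fst \<gamma>) * snd \<gamma>)"
  by (cases \<gamma>; cases \<beta>) (simp add: refl_by_def aff_form_def cartan_def)

lemma aff_simple_cases:
  assumes "\<gamma> \<in> SS"
  obtains g where "g \<in> \<Delta>" "\<gamma> = (g, 0)" | "\<gamma> = (- \<omega>, 1)"
  using assms by (auto simp: aff_simple_def)

lemma aff_simple_aroots: "\<gamma> \<in> SS \<Longrightarrow> \<gamma> \<in> aroots"
  by (erule aff_simple_cases) (auto simp: aroots_def simple_in_roots neg_root omega_root)

lemma aff_simple_lay: "\<gamma> \<in> SS \<Longrightarrow> lay \<gamma> = 0"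
  by (erule aff_simple_cases)
    (auto simp: lay_def pos_simple pos_minus_iff[OF omega_root] omega_pos)

lemma srefl_aroots:
  assumes "\<beta> \<in> aroots" "\<gamma> \<in> SS"
  shows "srefl \<gamma> \<beta> \<in> aroots"
  using assms aff_simple_aroots[OF assms(2)] refl_root cartan_Ints
  by (auto simp: aroots_def srefl_eq)

lemma refl_neg: "refl_by (\<bullet>) (- g) = refl_by (\<bullet>) g" for g :: 'a
  by (rule ext) (simp add: refl_by_def)

lemma refl_of_neg: "refl_by (\<bullet>) g (- a) = - refl_by (\<bullet>) g a" for g a :: 'a
  by (simp add: refl_by_def algebra_simps)

lemma cartan_neg: "cartan a (- g) = - cartan a g" "cartan (- a) g = - cartan a g" for g a :: 'a
  by (simp_all add: cartan_def)

lemma lay_neg: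
  assumes "fst \<beta> \<in> \<Phi>"
  shows "lay (- \<beta>) = - 1 - lay \<beta>"
  using pos_minus_iff[OF assms] by (simp add: lay_def)

lemma srefl_neg:
  fixes \<beta> \<gamma> :: "'a \<times> real"
  shows "srefl \<gamma> (- \<beta>) = - srefl \<gamma> \<beta>"
  by (simp add: srefl_eq refl_of_neg cartan_neg)

text \<open>For \<gamma> = (g, 0) the sign of the finite part is preserved. For \<gamma> = \<delta>
  - \<omega> either the finite part is fixed, or a positive one turns negative while the
  \<delta>-coordinate grows by 1, which is the offset in \<open>lay\<close>. Negative finite parts
  reduce to positive ones by passing to \<open>- \<beta>\<close>.\<close>

lemma lay_srefl_other:
  assumes "\<beta> \<in> aroots" "\<gamma> \<in> SS" "fst \<beta> \<noteq> fst \<gamma>" "fst \<beta> \<noteq> - fst \<gamma>"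
  shows "lay (srefl \<gamma> \<beta>) = lay \<beta>"
proof -
  have pos_case: "lay (srefl \<gamma> \<beta>) = lay \<beta>"
    if \<beta>: "\<beta> \<in> aroots" "fst \<beta> \<noteq> fst \<gamma>" "fst \<beta> \<noteq> - fst \<gamma>" and p: "pos (fst \<beta>)" for \<beta>
    using assms(2)
  proof (cases rule: aff_simple_cases)
    case (1 g)
    have "pos (refl_by (\<bullet>) g (fst \<beta>))"
      using pos_refl_simple[of "fst \<beta>" g] 1 \<beta> p by (auto simp: aroots_def)
    thus ?thesis using 1 p by (simp add: srefl_eq lay_def)
  next
    case 2
    have "fst \<beta> \<in> \<Phi>" "fst \<beta> \<noteq> \<omega>" using \<beta> 2 by (auto simp: aroots_def)
    from cartan_omega[OF this(1) p this(2)]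
    consider "cartan (fst \<beta>) \<omega> = 0" | "cartan (fst \<beta>) \<omega> = 1" "\<not> pos (refl_by (\<bullet>) \<omega> (fst \<beta>))" by blast
    thus ?thesis
    proof cases
      case 1
      hence "refl_by (\<bullet>) \<omega> (fst \<beta>) = fst \<beta>" by (simp add: refl_cartan)
      thus ?thesis using 1 2 by (simp add: srefl_eq lay_def refl_neg cartan_neg)
    next
      case c: 2
      thus ?thesis using 2 p by (simp add: srefl_eq lay_def refl_neg cartan_neg)
    qed
  qed
  show ?thesis
  proof (cases "pos (fst \<beta>)")
    case False
    have r: "fst \<beta> \<in> \<Phi>" using assms(1) by (auto simp: aroots_def)
    have "lay (srefl \<gamma> (- \<beta>)) = lay (- \<beta>)"
    proof (rule pos_case)
      show "- \<beta> \<in> aroots" using assms(1) neg_root by (cases \<beta>) (auto simp: aroots_def)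
      show "pos (fst (- \<beta>))" using False r pos_or_neg by auto
      show "fst (- \<beta>) \<noteq> fst \<gamma>" using assms(4) by (metis fst_uminus minus_minus)
      show "fst (- \<beta>) \<noteq> - fst \<gamma>" using assms(3) by simp
    qed
    moreover have "fst (srefl \<gamma> \<beta>) \<in> \<Phi>"
      using srefl_aroots[OF assms(1,2)] by (auto simp: aroots_def)
    ultimately show ?thesis using lay_neg[OF r] lay_neg[of "srefl \<gamma> \<beta>"] by (simp add: srefl_neg)
  qed (use pos_case assms in blast)
qed

lemma cartan_self: "g \<noteq> 0 \<Longrightarrow> cartan g g = 2"
  by (simp add: cartan_def)

text \<open>Here \<beta> is \<gamma> plus a multiple of \<delta>, and its finite part is negated.
  For \<gamma> = (g, 0) only the sign changes; for \<gamma> = \<delta> - \<omega> the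
  \<delta>-coordinate drops by 2 and the sign change gives 1 back.\<close>

lemma lay_srefl_same:
  assumes "\<gamma> \<in> SS" "fst \<beta> = fst \<gamma>"
  shows "lay (srefl \<gamma> \<beta>) = lay \<beta> - 1"
  using assms(1)
proof (cases rule: aff_simple_cases)
  case (1 g)
  have "\<not> pos (- g)" using pos_minus_iff pos_simple simple_in_roots 1 by blast
  thus ?thesis
    using 1 assms(2) refl_by_inner_self[of g] root_nonzero[OF simple_in_roots] pos_simple
    by (auto simp: srefl_eq lay_def)
next
  case 2
  have "\<not> pos (- \<omega>)" using pos_minus_iff omega_pos omega_root by blast
  thus ?thesis
    using 2 assms(2) refl_by_inner_self[of \<omega>] root_nonzero[OF omega_root] omega_pos
    by (simp add: srefl_eq lay_def refl_neg refl_of_neg cartan_neg cartan_self)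
qed

lemma lay_srefl_opposite:
  assumes "\<gamma> \<in> SS" "fst \<beta> = - fst \<gamma>"
  shows "lay (srefl \<gamma> \<beta>) = lay \<beta> + 1"
proof -
  have g: "fst \<gamma> \<in> \<Phi>" using aff_simple_aroots[OF assms(1)] by (auto simp: aroots_def)
  hence b: "fst \<beta> \<in> \<Phi>" using assms(2) neg_root by simp
  have "fst (srefl \<gamma> \<beta>) \<in> \<Phi>" using refl_root[OF b g] by (simp add: srefl_eq)
  from lay_neg[OF this] lay_neg[OF b] show ?thesis
    using lay_srefl_same[OF assms(1), of "- \<beta>"] assms(2) by (simp add: srefl_neg)
qed

lemma aff_pos_iff: "\<beta> \<in> aff_pos \<Phi> \<Delta> \<longleftrightarrow> \<beta> \<in> aroots \<and> lay \<beta> \<ge> 0"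
proof
  assume "\<beta> \<in> aff_pos \<Phi> \<Delta>"
  thus "\<beta> \<in> aroots \<and> lay \<beta> \<ge> 0"
    using pos_minus_iff neg_root
    by (auto simp: aff_pos_def layer_def pos_roots0_def aroots_def lay_def)
next
  assume \<beta>: "\<beta> \<in> aroots \<and> lay \<beta> \<ge> 0"
  then obtain a i where ai: "\<beta> = (a, of_int i)" "a \<in> \<Phi>" by (auto simp: aroots_def elim!: Ints_cases)
  show "\<beta> \<in> aff_pos \<Phi> \<Delta>"
  proof (cases "pos a")
    case True
    hence "\<beta> \<in> layer (pos_roots0 \<Phi> \<Delta>) (nat i)"
      using \<beta> ai by (auto simp: lay_def layer_def pos_roots0_def)
    thus ?thesis by (auto simp: aff_pos_def)
  next
    case False
    hence "pos (- a)" "- a \<in> \<Phi>" using ai neg_root pos_or_neg by auto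
    moreover have "i \<ge> 1" using \<beta> ai False by (simp add: lay_def)
    ultimately have "\<beta> \<in> layer (pos_roots0 \<Phi> \<Delta>) (nat (i - 1))"
      using ai by (auto simp: layer_def pos_roots0_def intro!: exI[where x = "- a"])
    thus ?thesis by (auto simp: aff_pos_def)
  qed
qed

text \<open>Closure under negation merges the two halves of a layer into one condition that does not
  mention the sign of the finite part.\<close>

lemma Sigma_orb_iff:
  assumes "\<O> \<subseteq> \<Phi>" "\<And>a. a \<in> \<O> \<Longrightarrow> - a \<in> \<O>"
  shows "\<beta> \<in> Sigma_orb \<Phi> \<Delta> \<O> k \<longleftrightarrow> fst \<beta> \<in> \<O> \<and> lay \<beta> = real k"
proof
  assume "\<beta> \<in> Sigma_orb \<Phi> \<Delta> \<O> k"
  thus "fst \<beta> \<in> \<O> \<and> lay \<beta> = real k"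
    using assms(2) pos_minus_iff
    by (auto simp: Sigma_orb_def layer_def pos_roots0_def lay_def)
next
  assume \<beta>: "fst \<beta> \<in> \<O> \<and> lay \<beta> = real k"
  obtain a m where am: "\<beta> = (a, m)" by fastforce
  show "\<beta> \<in> Sigma_orb \<Phi> \<Delta> \<O> k"
  proof (cases "pos a")
    case True
    thus ?thesis using \<beta> am assms(1) by (auto simp: Sigma_orb_def layer_def pos_roots0_def lay_def)
  next
    case False
    have "a \<in> \<Phi>" "- a \<in> \<O>" using \<beta> am assms by auto
    moreover hence "pos (- a)" "- a \<in> \<Phi>" using False pos_or_neg neg_root by auto
    moreover have "m = real (k + 1)" using \<beta> am False by (simp add: lay_def)
    ultimately show ?thesis using am
      by (auto simp: Sigma_orb_def layer_def pos_roots0_def intro!: exI[where x = "- a"])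
  qed
qed

section \<open>Weighted heights, the closed form of the depth, and descents\<close>

definition wsum0 :: "('a \<Rightarrow> real) \<Rightarrow> 'a \<Rightarrow> real" where
  "wsum0 f a = (\<Sum>g\<in>\<Delta>. coef a g * f g)"

text \<open>The linear functional on \<open>V\<close> with value \<open>f \<alpha>\<^sub>s\<close> at \<open>\<alpha>\<^sub>s\<close> for \<open>\<alpha>\<^sub>s \<in> \<Delta>\<^sub>0\<close> and value \<open>f \<omega>\<close>
  at \<open>\<delta> - \<omega>\<close>.\<close>

definition wsum :: "('a \<Rightarrow> real) \<Rightarrow> 'a \<times> real \<Rightarrow> real" where
  "wsum f \<beta> = wsum0 f (fst \<beta>) + snd \<beta> * (wsum0 f \<omega> + f \<omega>)"

lemma wsum0_add: "wsum0 f (a + b) = wsum0 f a + wsum0 f b"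
  and wsum0_diff: "wsum0 f (a - b) = wsum0 f a - wsum0 f b"
  and wsum0_scaleR: "wsum0 f (c *\<^sub>R a) = c * wsum0 f a"
  and wsum0_minus: "wsum0 f (- a) = - wsum0 f a"
  by (simp_all add: wsum0_def coef_add coef_diff coef_scaleR coef_minus sum.distrib sum_subtractf
      sum_distrib_left sum_negf algebra_simps)

lemma wsum0_nonneg: "(\<And>g. f g \<ge> 0) \<Longrightarrow> pos a \<Longrightarrow> wsum0 f a \<ge> 0"
  unfolding wsum0_def using pos_coef_nonneg by (intro sum_nonneg mult_nonneg_nonneg) auto

lemma wsum_srefl: "wsum f (srefl \<gamma> \<beta>) = wsum f \<beta> - cartan (fst \<beta>) (fst \<gamma>) * wsum f \<gamma>"
  by (simp add: wsum_def srefl_eq refl_cartan wsum0_diff wsum0_scaleR algebra_simps)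

text \<open>Weights are indexed by finite parts; that of \<delta> - \<omega> is -\<omega>, while
  \<open>wsum\<close> is built from \<open>f \<omega>\<close>, hence the first hypothesis.\<close>

lemma wsum_simple:
  assumes "f (- \<omega>) = f \<omega>" "\<gamma> \<in> SS"
  shows "wsum f \<gamma> = f (fst \<gamma>)"
  using assms(2)
proof (cases rule: aff_simple_cases)
  case (1 g)
  have "wsum0 f g = (\<Sum>h\<in>\<Delta>. if h = g then f h else 0)"
    unfolding wsum0_def using 1 by (intro sum.cong) (auto simp: coef_simple)
  thus ?thesis using 1 finite_simple by (simp add: wsum_def)
qed (simp add: wsum_def wsum0_minus assms(1))

text \<open>Positive affine roots are nonnegative combinations of simple ones: \<delta> = \<omega> +
  (\<delta> - \<omega>), and for positive a, (k+1)\<delta> - a = (\<omega> - a) + k\<delta> +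
  (\<delta> - \<omega>).\<close>

lemma wsum_nonneg:
  assumes f: "\<And>g. f g \<ge> 0" and \<beta>: "\<beta> \<in> aroots" "lay \<beta> \<ge> 0"
  shows "wsum f \<beta> \<ge> 0"
proof (cases "pos (fst \<beta>)")
  case True
  thus ?thesis using \<beta>(2) wsum0_nonneg[OF f] omega_pos f by (simp add: wsum_def lay_def)
next
  case False
  have "- fst \<beta> \<in> \<Phi>" using \<beta>(1) neg_root by (auto simp: aroots_def)
  from wsum0_nonneg[OF f omega_diff_pos[OF this]]
  have "wsum0 f \<omega> + wsum0 f (fst \<beta>) \<ge> 0" by (simp add: wsum0_add)
  moreover have "(snd \<beta> - 1) * (wsum0 f \<omega> + f \<omega>) \<ge> 0"
    using \<beta>(2) False wsum0_nonneg[OF f omega_pos] f by (auto simp: lay_def)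
  moreover have "wsum f \<beta> = (wsum0 f \<omega> + wsum0 f (fst \<beta>)) + (snd \<beta> - 1) * (wsum0 f \<omega> + f \<omega>) + f \<omega>"
    by (simp add: wsum_def algebra_simps)
  ultimately show ?thesis using f[of \<omega>] by simp
qed

definition wt :: "real \<Rightarrow> 'a \<Rightarrow> real" where
  "wt q g = min 1 ((g \<bullet> g) / q)"

text \<open>Defined on negative roots as well, where it can be negative; the one-step formula
  \<open>dpt_srefl\<close> holds there too, so a word may pass through them.\<close>

definition dpt :: "'a \<times> real \<Rightarrow> real" where
  "dpt \<beta> = wsum (wt (fst \<beta> \<bullet> fst \<beta>)) \<beta> - 1 - lay \<beta>"

text \<open>Reflections preserve \<open>q\<close>, so one and the same functional evaluates both
  sides.\<close>

lemma dpt_srefl: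
  assumes \<beta>: "\<beta> \<in> aroots" and \<gamma>: "\<gamma> \<in> SS"
  shows "dpt (srefl \<gamma> \<beta>) = dpt \<beta> - sgn (aff_form \<beta> \<gamma>)"
proof -
  define q where "q = fst \<beta> \<bullet> fst \<beta>"
  have q': "fst (srefl \<gamma> \<beta>) \<bullet> fst (srefl \<gamma> \<beta>) = q"
    by (simp add: srefl_eq inner_refl_by q_def)
  have ws: "wsum (wt q) (srefl \<gamma> \<beta>) = wsum (wt q) \<beta> - cartan (fst \<beta>) (fst \<gamma>) * wt q (fst \<gamma>)"
    by (simp add: wsum_srefl wsum_simple[OF _ \<gamma>] wt_def)
  have r: "fst \<beta> \<in> \<Phi>" "fst \<gamma> \<in> \<Phi>" using \<beta> aff_simple_aroots[OF \<gamma>] by (auto simp: aroots_def)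
  note nz = root_nonzero[OF r(1)] root_nonzero[OF r(2)]
  consider "fst \<beta> = fst \<gamma>" | "fst \<beta> = - fst \<gamma>" | "fst \<beta> \<noteq> fst \<gamma>" "fst \<beta> \<noteq> - fst \<gamma>" by blast
  thus ?thesis
  proof cases
    \<comment> \<open>The weight of \<gamma> is 1 here, so the functional drops by the Cartan number
      2 and \<open>lay\<close> by 1.\<close>
    case 1
    thus ?thesis using lay_srefl_same[OF \<gamma> 1] ws nz
      by (simp add: dpt_def q' flip: q_def) (simp add: q_def wt_def cartan_def aff_form_def)
  next
    case 2
    thus ?thesis using lay_srefl_opposite[OF \<gamma> 2] ws nz
      by (simp add: dpt_def q' flip: q_def) (simp add: q_def wt_def cartan_def aff_form_def)
  next
    \<comment> \<open>Reducedness excludes proportional finite parts, so the weighted Cartan integer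
      is a sign.\<close>
    case 3
    have "cartan (fst \<beta>) (fst \<gamma>) * wt q (fst \<gamma>) = sgn (fst \<beta> \<bullet> fst \<gamma>)"
      unfolding wt_def q_def
      using nz 3 root_scaleR[OF r] cartan_Ints[OF r] cartan_Ints[OF r(2,1)]
      by (intro cartan_min_weight) auto
    thus ?thesis using lay_srefl_other[OF \<beta> \<gamma> 3] ws
      by (simp add: dpt_def q' aff_form_def flip: q_def)
  qed
qed

lemma dpt_simple:
  assumes "\<gamma> \<in> SS"
  shows "dpt \<gamma> = 0"
proof -
  have "fst \<gamma> \<noteq> 0" using aff_simple_aroots[OF assms] root_nonzero by (auto simp: aroots_def)
  thus ?thesis using assms by (simp add: dpt_def wsum_simple aff_simple_lay wt_def)
qed

text \<open>A positive finite part has positive inner product with itself, hence with some simple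
  root. For finite part -a with a positive, \<delta> - \<omega> works unless a is orthogonal to
  \<omega>; in that case -a has positive inner product with \<omega> - a, which is again a
  nonnegative combination of simple roots.\<close>

lemma exists_descent:
  assumes \<beta>: "\<beta> \<in> aroots" "lay \<beta> \<ge> 0"
  obtains \<gamma> where "\<gamma> \<in> SS" "aff_form \<beta> \<gamma> > 0"
proof (cases "pos (fst \<beta>)")
  case True
  have "fst \<beta> \<bullet> fst \<beta> > 0" using \<beta> root_nonzero by (auto simp: aroots_def)
  with True obtain g where "g \<in> \<Delta>" "fst \<beta> \<bullet> g > 0" using exists_simple_inner_pos by metis
  thus thesis using that[of "(g, 0)"] by (auto simp: aff_simple_def aff_form_def)
next
  case False
  define a where "a = - fst \<beta>"
  have "fst \<beta> \<in> \<Phi>" using \<beta> by (auto simp: aroots_def)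
  hence a: "a \<in> \<Phi>" "pos a" using False neg_root pos_or_neg by (auto simp: a_def)
  show thesis
  proof (cases "a \<bullet> \<omega> = 0")
    case True
    have "(- a) \<bullet> (\<omega> - a) > 0" using True root_nonzero[OF a(1)] by (simp add: inner_diff_right)
    then obtain g where "g \<in> \<Delta>" "(- a) \<bullet> g > 0"
      using exists_simple_inner_pos[OF omega_diff_pos[OF a(1)]] by metis
    thus thesis using that[of "(g, 0)"] by (auto simp: aff_simple_def aff_form_def a_def)
  next
    case False
    hence "a \<bullet> \<omega> > 0" using omega_dominant[OF a(2)] by (simp add: inner_commute)
    thus thesis using that[of "(- \<omega>, 1)"] by (auto simp: aff_simple_def aff_form_def a_def)
  qed
qed

lemma lay_Ints: "\<beta> \<in> aroots \<Longrightarrow> lay \<beta> \<in> \<int>"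
  by (auto simp: aroots_def lay_def)

text \<open>The layer drops only when the finite parts agree, and in layer 0 this forces \<beta> =
  \<gamma>.\<close>

lemma lay_srefl_nonneg:
  assumes \<beta>: "\<beta> \<in> aroots" "lay \<beta> \<ge> 0" and \<gamma>: "\<gamma> \<in> SS" "\<beta> \<noteq> \<gamma>"
  shows "lay (srefl \<gamma> \<beta>) \<ge> 0"
proof (cases "fst \<beta> = fst \<gamma>")
  case True
  have "lay \<beta> \<noteq> 0"
  proof
    assume "lay \<beta> = 0"
    hence "lay \<beta> = lay \<gamma>" using aff_simple_lay[OF \<gamma>(1)] by simp
    hence "snd \<beta> = snd \<gamma>" using True by (simp add: lay_def)
    thus False using True \<gamma>(2) by (simp add: prod_eq_iff)
  qed
  hence "lay \<beta> \<ge> 1" using \<beta>(2) lay_Ints[OF \<beta>(1)] by (auto elim!: Ints_cases)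
  thus ?thesis using lay_srefl_same[OF \<gamma>(1) True] by simp
next
  case False
  thus ?thesis using lay_srefl_other[OF \<beta>(1) \<gamma>(1)] lay_srefl_opposite[OF \<gamma>(1)] \<beta>(2)
    by (cases "fst \<beta> = - fst \<gamma>") auto
qed

section \<open>Words in the affine generators and the depth\<close>

abbreviation "gens \<equiv> aff_gens \<Delta> \<omega>"

text \<open>Greedy descent, by induction on the ordinary height (all weights 1), which is known to
  be nonnegative on positive roots. That \<open>dpt\<close> is a natural number there only follows
  from this lemma.\<close>

lemma exists_word_to_simple:
  assumes "\<beta> \<in> aroots" "lay \<beta> \<ge> 0"
  shows "\<exists>ss. set ss \<subseteq> gens \<and> word_prod ss \<beta> \<in> SS \<and> real (length ss) = dpt \<beta>"
  using assms
proof (induction "nat \<lfloor>wsum (\<lambda>_. 1) \<beta>\<rfloor>" arbitrary: \<beta> rule: less_induct)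
  case less
  show ?case
  proof (cases "\<beta> \<in> SS")
    case True
    thus ?thesis by (intro exI[of _ "[]"]) (simp add: dpt_simple)
  next
    case False
    obtain \<gamma> where \<gamma>: "\<gamma> \<in> SS" "aff_form \<beta> \<gamma> > 0" using exists_descent less.prems by metis
    let ?b = "srefl \<gamma> \<beta>"
    have b: "?b \<in> aroots" "lay ?b \<ge> 0"
      using srefl_aroots[OF less.prems(1) \<gamma>(1)] lay_srefl_nonneg[OF less.prems \<gamma>(1)] False \<gamma>(1) by auto
    have "cartan (fst \<beta>) (fst \<gamma>) \<ge> 1"
      using less.prems(1) aff_simple_aroots[OF \<gamma>(1)] \<gamma>(2)
      by (intro cartan_ge_1) (auto simp: aroots_def aff_form_def)
    hence "wsum (\<lambda>_. 1) ?b \<le> wsum (\<lambda>_. 1) \<beta> - 1"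
      using wsum_srefl[of "\<lambda>_. 1" \<gamma> \<beta>] wsum_simple[of "\<lambda>_. 1", OF _ \<gamma>(1)] by simp
    moreover have "wsum (\<lambda>_. 1) ?b \<ge> 0" using wsum_nonneg b by simp
    ultimately have "nat \<lfloor>wsum (\<lambda>_. 1) ?b\<rfloor> < nat \<lfloor>wsum (\<lambda>_. 1) \<beta>\<rfloor>" by linarith
    from less.hyps[OF this b] obtain ss where ss: "set ss \<subseteq> gens" "word_prod ss ?b \<in> SS"
      "real (length ss) = dpt ?b" by blast
    have "real (length (ss @ [srefl \<gamma>])) = dpt \<beta>"
      using ss(3) dpt_srefl[OF less.prems(1) \<gamma>(1)] \<gamma>(2) by simp
    \<comment> \<open>Words act from right to left, so the reflection applied first goes to the
      end.\<close>
    thus ?thesis using ss \<gamma>(1)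
      by (intro exI[of _ "ss @ [srefl \<gamma>]"]) (auto simp: word_prod_append aff_gens_def)
  qed
qed

lemma word_aroots:
  "set ss \<subseteq> gens \<Longrightarrow> \<beta> \<in> aroots \<Longrightarrow> word_prod ss \<beta> \<in> aroots"
  by (induction ss) (auto simp: aff_gens_def srefl_aroots)

lemma dpt_srefl_le:
  assumes "\<beta> \<in> aroots" "\<gamma> \<in> SS"
  shows "\<bar>dpt (srefl \<gamma> \<beta>) - dpt \<beta>\<bar> \<le> 1"
  using dpt_srefl[OF assms] by (simp add: sgn_if)

lemma dpt_word_le:
  "set ss \<subseteq> gens \<Longrightarrow> \<beta> \<in> aroots \<Longrightarrow> \<bar>dpt (word_prod ss \<beta>) - dpt \<beta>\<bar> \<le> real (length ss)"
proof (induction ss)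
  case (Cons s ss)
  obtain \<gamma> where \<gamma>: "\<gamma> \<in> SS" "s = srefl \<gamma>" using Cons.prems by (auto simp: aff_gens_def)
  show ?case
    using Cons.IH Cons.prems dpt_srefl_le[OF word_aroots \<gamma>(1), of ss \<beta>] \<gamma>(2) by simp
qed simp

lemma dpt_aff_length_le:
  assumes "w \<in> aff_W \<Delta> \<omega>" "\<beta> \<in> aroots"
  shows "\<bar>dpt (w \<beta>) - dpt \<beta>\<bar> \<le> real (aff_length \<Delta> \<omega> w)"
proof -
  obtain ss where "set ss \<subseteq> gens" "word_prod ss = w" "length ss = aff_length \<Delta> \<omega> w"
    using reduced_word_exists assms(1) unfolding aff_W_def aff_length_def by metis
  thus ?thesis using dpt_word_le[OF _ assms(2)] by metis
qed

text \<open>The greedy word gives the upper bound. Conversely each letter changes \<open>dpt\<close>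
  by at most 1 and simple roots have value 0, so no shorter element reaches a simple root.\<close>

lemma depth_eq_dpt:
  assumes \<beta>: "\<beta> \<in> aff_pos \<Phi> \<Delta>"
  shows "real (depth \<Delta> \<omega> \<beta>) = dpt \<beta>"
proof -
  have b: "\<beta> \<in> aroots" "lay \<beta> \<ge> 0" using \<beta> by (auto simp: aff_pos_iff)
  obtain ss where ss: "set ss \<subseteq> gens" "word_prod ss \<beta> \<in> SS" "real (length ss) = dpt \<beta>"
    using exists_word_to_simple b by blast
  have lower: "length ss \<le> aff_length \<Delta> \<omega> w" if "w \<in> aff_W \<Delta> \<omega>" "w \<beta> \<in> SS" for w
    using dpt_aff_length_le[OF that(1) b(1)] dpt_simple[OF that(2)] ss(3) by simp
  have w: "word_prod ss \<in> aff_W \<Delta> \<omega>" using ss(1) by (auto simp: aff_W_def gen_group_def)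
  have "aff_length \<Delta> \<omega> (word_prod ss) \<le> length ss"
    unfolding aff_length_def by (rule word_length_le[OF ss(1) refl])
  with lower[OF w ss(2)] have "aff_length \<Delta> \<omega> (word_prod ss) = length ss" by simp
  hence "depth \<Delta> \<omega> \<beta> = length ss"
    unfolding depth_def using w ss(2) lower by (intro Least_equality) auto
  thus ?thesis using ss(3) by simp
qed

section \<open>The root poset: chains of ascents, layers and covers\<close>

text \<open>No element taking \<alpha> to \<beta> is shorter than the difference of the depths, so a
  word of that length is automatically reduced and no length function is needed.\<close>

lemma root_le_iff:
  "le \<alpha> \<beta> \<longleftrightarrow> \<alpha> \<in> aff_pos \<Phi> \<Delta> \<and> \<beta> \<in> aff_pos \<Phi> \<Delta> \<and>
     (\<exists>ss. set ss \<subseteq> gens \<and> word_prod ss \<alpha> = \<beta> \<and> real (length ss) = dpt \<beta> - dpt \<alpha>)"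
  (is "_ \<longleftrightarrow> _ \<and> _ \<and> ?R")
proof -
  have "(\<exists>w\<in>aff_W \<Delta> \<omega>. w \<alpha> = \<beta> \<and>
        int (aff_length \<Delta> \<omega> w) = int (depth \<Delta> \<omega> \<beta>) - int (depth \<Delta> \<omega> \<alpha>)) \<longleftrightarrow> ?R"
    (is "?L \<longleftrightarrow> ?R") if a: "\<alpha> \<in> aff_pos \<Phi> \<Delta>" and b: "\<beta> \<in> aff_pos \<Phi> \<Delta>"
  proof -
    have dd: "real (aff_length \<Delta> \<omega> w) = dpt \<beta> - dpt \<alpha> \<longleftrightarrow>
       int (aff_length \<Delta> \<omega> w) = int (depth \<Delta> \<omega> \<beta>) - int (depth \<Delta> \<omega> \<alpha>)" for w
      using depth_eq_dpt[OF a] depth_eq_dpt[OF b] by linarith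
    show ?thesis
    proof
      assume ?L
      then obtain w where w: "w \<in> aff_W \<Delta> \<omega>" "w \<alpha> = \<beta>" "real (aff_length \<Delta> \<omega> w) = dpt \<beta> - dpt \<alpha>"
        using dd by blast
      obtain ss where "set ss \<subseteq> gens" "word_prod ss = w" "length ss = aff_length \<Delta> \<omega> w"
        using reduced_word_exists w(1) unfolding aff_W_def aff_length_def by metis
      thus ?R using w by auto
    next
      assume ?R
      then obtain ss where ss: "set ss \<subseteq> gens" "word_prod ss \<alpha> = \<beta>" "real (length ss) = dpt \<beta> - dpt \<alpha>"
        by blast
      have w: "word_prod ss \<in> aff_W \<Delta> \<omega>" using ss(1) by (auto simp: aff_W_def gen_group_def)
      have "aff_length \<Delta> \<omega> (word_prod ss) \<le> length ss"
        unfolding aff_length_def by (rule word_length_le[OF ss(1) refl])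
      moreover have "\<alpha> \<in> aroots" using a by (simp add: aff_pos_iff)
      note dpt_aff_length_le[OF w this]
      ultimately have "real (aff_length \<Delta> \<omega> (word_prod ss)) = dpt \<beta> - dpt \<alpha>"
        using ss(2,3) by simp
      thus ?L using w ss(2) dd by blast
    qed
  qed
  thus ?thesis unfolding root_le_def by blast
qed

lemma root_le_dpt_less:
  assumes "le \<alpha> \<beta>" "\<alpha> \<noteq> \<beta>"
  shows "dpt \<beta> \<ge> dpt \<alpha> + 1"
proof -
  obtain ss where ss: "word_prod ss \<alpha> = \<beta>" "real (length ss) = dpt \<beta> - dpt \<alpha>"
    using assms(1) root_le_iff by blast
  have "ss \<noteq> []" using ss(1) assms(2) by auto
  hence "length ss \<ge> 1" by (cases ss) auto
  thus ?thesis using ss(2) by linarith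
qed

lemma root_le_srefl:
  assumes "\<alpha> \<in> aff_pos \<Phi> \<Delta>" "\<gamma> \<in> SS" "aff_form \<alpha> \<gamma> < 0"
  shows "le \<alpha> (srefl \<gamma> \<alpha>)" "srefl \<gamma> \<alpha> \<noteq> \<alpha>"
    and "lay (srefl \<gamma> \<alpha>) = (if fst \<alpha> = - fst \<gamma> then lay \<alpha> + 1 else lay \<alpha>)"
proof -
  have a: "\<alpha> \<in> aroots" "lay \<alpha> \<ge> 0" using assms(1) by (auto simp: aff_pos_iff)
  have d: "dpt (srefl \<gamma> \<alpha>) = dpt \<alpha> + 1" using dpt_srefl[OF a(1) assms(2)] assms(3) by simp
  thus "srefl \<gamma> \<alpha> \<noteq> \<alpha>" by auto
  \<comment> \<open>Equal finite parts would make the form a square norm, so the layer-lowering case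
    cannot occur.\<close>
  have ne: "fst \<alpha> \<noteq> fst \<gamma>" using assms(3) by (metis aff_form_def inner_ge_zero not_less)
  thus l: "lay (srefl \<gamma> \<alpha>) = (if fst \<alpha> = - fst \<gamma> then lay \<alpha> + 1 else lay \<alpha>)"
    using lay_srefl_other[OF a(1) assms(2)] lay_srefl_opposite[OF assms(2)] by auto
  have "srefl \<gamma> \<alpha> \<in> aff_pos \<Phi> \<Delta>"
    using srefl_aroots[OF a(1) assms(2)] l a(2) by (auto simp: aff_pos_iff)
  thus "le \<alpha> (srefl \<gamma> \<alpha>)"
    unfolding root_le_iff using assms d by (auto simp: aff_gens_def intro!: exI[of _ "[srefl \<gamma>]"])
qed

text \<open>A word whose length equals the gain in depth has no slack: each letter raises the depth
  by 1, in particular the last one, which acts first.\<close>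

lemma root_le_first_step:
  assumes "le \<alpha> \<beta>" "\<alpha> \<noteq> \<beta>"
  obtains \<gamma> where "\<gamma> \<in> SS" "aff_form \<alpha> \<gamma> < 0" "le (srefl \<gamma> \<alpha>) \<beta>"
proof -
  obtain ss where ss: "set ss \<subseteq> gens" "word_prod ss \<alpha> = \<beta>" "real (length ss) = dpt \<beta> - dpt \<alpha>"
    and ab: "\<alpha> \<in> aff_pos \<Phi> \<Delta>" "\<beta> \<in> aff_pos \<Phi> \<Delta>"
    using assms(1) root_le_iff by blast
  have "ss \<noteq> []" using ss(2) assms(2) by auto
  then obtain ts s where ts: "ss = ts @ [s]" by (metis rev_exhaust)
  then obtain \<gamma> where \<gamma>: "\<gamma> \<in> SS" "s = srefl \<gamma>" using ss(1) by (auto simp: aff_gens_def)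
  have a: "\<alpha> \<in> aroots" using ab by (simp add: aff_pos_iff)
  let ?b = "srefl \<gamma> \<alpha>"
  have b: "?b \<in> aroots" using srefl_aroots[OF a \<gamma>(1)] .
  have w: "set ts \<subseteq> gens" "word_prod ts ?b = \<beta>" using ss(1,2) ts \<gamma>(2) by (auto simp: word_prod_append)
  have le: "dpt \<beta> - dpt ?b \<le> real (length ts)" using dpt_word_le[OF w(1) b] w(2) by simp
  hence "dpt ?b \<ge> dpt \<alpha> + 1" using ss(3) ts by simp
  hence neg: "aff_form \<alpha> \<gamma> < 0" using dpt_srefl[OF a \<gamma>(1)] by (simp add: sgn_if split: if_splits)
  hence "real (length ts) = dpt \<beta> - dpt ?b" using dpt_srefl[OF a \<gamma>(1)] ss(3) ts by simp
  moreover have "?b \<in> aff_pos \<Phi> \<Delta>" using root_le_srefl(1)[OF ab(1) \<gamma>(1) neg] by (simp add: root_le_iff)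
  ultimately have "le ?b \<beta>" unfolding root_le_iff using w ab by blast
  thus thesis using that \<gamma>(1) neg by blast
qed

text \<open>Ascents are peeled off one by one; each keeps the layer or raises it by 1.\<close>

lemma root_le_lay_mono: "le \<alpha> \<beta> \<Longrightarrow> lay \<alpha> \<le> lay \<beta>"
proof (induction "nat \<lfloor>dpt \<beta> - dpt \<alpha>\<rfloor>" arbitrary: \<alpha> rule: less_induct)
  case less
  show ?case
  proof (cases "\<alpha> = \<beta>")
    case False
    then obtain \<gamma> where \<gamma>: "\<gamma> \<in> SS" "aff_form \<alpha> \<gamma> < 0" "le (srefl \<gamma> \<alpha>) \<beta>"
      using root_le_first_step less.prems by metis
    have a: "\<alpha> \<in> aff_pos \<Phi> \<Delta>" using less.prems by (simp add: root_le_iff)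
    have "dpt (srefl \<gamma> \<alpha>) = dpt \<alpha> + 1" using dpt_srefl[OF _ \<gamma>(1)] a \<gamma>(2) by (simp add: aff_pos_iff)
    moreover have "dpt \<beta> \<ge> dpt \<alpha> + 1" using root_le_dpt_less less.prems False by blast
    ultimately have "nat \<lfloor>dpt \<beta> - dpt (srefl \<gamma> \<alpha>)\<rfloor> < nat \<lfloor>dpt \<beta> - dpt \<alpha>\<rfloor>" by linarith
    from less.hyps[OF this \<gamma>(3)] show ?thesis using root_le_srefl(3)[OF a \<gamma>(1,2)] by (auto split: if_splits)
  qed simp
qed

text \<open>The first ascent of a chain from \<alpha> to \<beta> stays in the orbit and in the
  layer, so the covering property makes it the whole chain.\<close>

lemma covers_on_orbit_layer:
  assumes \<O>: "\<O> \<subseteq> \<Phi>" "\<And>a. a \<in> \<O> \<Longrightarrow> - a \<in> \<O>"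
      "\<And>g a. g \<in> \<Delta> \<Longrightarrow> a \<in> \<O> \<Longrightarrow> refl_by (\<bullet>) g a \<in> \<O>"
    and cov: "covers_on le (Sigma_orb \<Phi> \<Delta> \<O> k) \<alpha> \<beta>"
  shows "short_cover \<Phi> \<Delta> \<omega> \<alpha> \<beta>"
proof -
  note Sig = Sigma_orb_iff[OF \<O>(1,2)]
  have ab: "fst \<alpha> \<in> \<O>" "lay \<alpha> = real k" "fst \<beta> \<in> \<O>" "lay \<beta> = real k" "le \<alpha> \<beta>" "\<alpha> \<noteq> \<beta>"
    and nob: "\<And>z. \<lbrakk>fst z \<in> \<O>; lay z = real k; le \<alpha> z; le z \<beta>; z \<noteq> \<alpha>\<rbrakk> \<Longrightarrow> z = \<beta>"
    using cov by (auto simp: covers_on_def Sig)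
  obtain \<gamma> where \<gamma>: "\<gamma> \<in> SS" "aff_form \<alpha> \<gamma> < 0" "le (srefl \<gamma> \<alpha>) \<beta>"
    using root_le_first_step ab by metis
  let ?z = "srefl \<gamma> \<alpha>"
  have pos: "\<alpha> \<in> aff_pos \<Phi> \<Delta>" "\<beta> \<in> aff_pos \<Phi> \<Delta>" using ab(5) by (simp_all add: root_le_iff)
  hence a: "\<alpha> \<in> aroots" by (simp add: aff_pos_iff)
  \<comment> \<open>The layer of \<open>?z\<close> is squeezed between the equal layers of \<alpha>
    and \<beta>.\<close>
  have nopp: "fst \<alpha> \<noteq> - fst \<gamma>" and lz: "lay ?z = real k"
    using root_le_lay_mono[OF \<gamma>(3)] root_le_srefl(3)[OF pos(1) \<gamma>(1,2)] ab(2,4) by (auto split: if_splits)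
  \<comment> \<open>The reflection in \<delta> - \<omega> acts on finite parts as the one in
    \<omega>, which need not be simple.\<close>
  have "fst ?z \<in> \<O>"
    using \<gamma>(1)
  proof (cases rule: aff_simple_cases)
    case 2
    show ?thesis using closed_under_pos_refl[of \<O> \<omega>, OF \<O>(3) omega_root omega_pos ab(1)] 2
      by (simp add: srefl_eq refl_neg)
  qed (simp add: srefl_eq \<O>(3) ab(1))
  from nob[OF this lz root_le_srefl(1)[OF pos(1) \<gamma>(1,2)] \<gamma>(3) root_le_srefl(2)[OF pos(1) \<gamma>(1,2)]]
  have \<beta>: "\<beta> = ?z" by simp
  have d: "dpt \<beta> = dpt \<alpha> + 1" using dpt_srefl[OF a \<gamma>(1)] \<gamma>(2) \<beta> by simp
  \<comment> \<open>A depth difference of 1 leaves no room for any root in between, whatever its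
    orbit or layer.\<close>
  have "\<not> (\<exists>z\<in>aff_pos \<Phi> \<Delta>. z \<noteq> \<alpha> \<and> z \<noteq> \<beta> \<and> le \<alpha> z \<and> le z \<beta>)"
  proof safe
    fix z assume "le \<alpha> z" "le z \<beta>" "z \<noteq> \<alpha>" "z \<noteq> \<beta>"
    hence "dpt \<alpha> + 1 \<le> dpt z" "dpt z + 1 \<le> dpt \<beta>" using root_le_dpt_less by blast+
    thus False using d by simp
  qed
  hence "covers_on le (aff_pos \<Phi> \<Delta>) \<alpha> \<beta>" using ab pos by (auto simp: covers_on_def)
  \<comment> \<open>The finite parts are neither equal nor opposite, hence not proportional, and
    strict Cauchy-Schwarz gives shortness.\<close>
  moreover have "- (aff_norm \<alpha> * aff_norm \<gamma>) < aff_form \<alpha> \<gamma>"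
  proof -
    have r: "fst \<alpha> \<in> \<Phi>" "fst \<gamma> \<in> \<Phi>" using a aff_simple_aroots[OF \<gamma>(1)] by (auto simp: aroots_def)
    have ne: "fst \<alpha> \<noteq> fst \<gamma>" using \<gamma>(2) by (metis aff_form_def inner_ge_zero not_less)
    have "(fst \<alpha> \<bullet> fst \<gamma>)\<^sup>2 < (fst \<alpha> \<bullet> fst \<alpha>) * (fst \<gamma> \<bullet> fst \<gamma>)"
      using root_nonzero[OF r(2)] root_scaleR[OF r] ne nopp by (intro inner_square_less) auto
    hence "sqrt ((fst \<alpha> \<bullet> fst \<gamma>)\<^sup>2) < sqrt ((fst \<alpha> \<bullet> fst \<alpha>) * (fst \<gamma> \<bullet> fst \<gamma>))"
      by (rule real_sqrt_less_mono)
    thus ?thesis by (simp add: aff_norm_def aff_form_def real_sqrt_mult)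
  qed
  moreover have "\<alpha> \<noteq> \<gamma>" using \<gamma>(2) by (metis aff_form_def inner_ge_zero not_less)
  ultimately show ?thesis using \<gamma>(1,2) \<beta> by (auto simp: short_cover_def)
qed

section \<open>Translation by multiples of \<delta>, and orbits\<close>

text \<open>Every reflection fixes \<delta>, which lies in the radical of the form.\<close>

lemma word_prod_translate:
  fixes v :: "'a \<times> real"
  shows "set ss \<subseteq> gens \<Longrightarrow> word_prod ss (v + (0, t)) = word_prod ss v + (0, t)"
proof (induction ss)
  case (Cons s ss)
  have "srefl \<gamma> (u + (0, t)) = srefl \<gamma> u + (0, t)" for \<gamma> u :: "'a \<times> real"
    by (simp add: srefl_eq prod_eq_iff)
  moreover obtain \<gamma> where "s = srefl \<gamma>" using Cons.prems by (auto simp: aff_gens_def)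
  ultimately show ?case using Cons by simp
qed simp

lemma lay_translate: "lay (\<beta> + (0, t)) = lay \<beta> + t"
  by (simp add: lay_def)

text \<open>Roots of equal length share the functional, so the translation adds the same constant to
  both values.\<close>

lemma dpt_translate:
  assumes "fst \<alpha> \<bullet> fst \<alpha> = fst \<beta> \<bullet> fst \<beta>"
  shows "dpt (\<beta> + (0, t)) - dpt (\<alpha> + (0, t)) = dpt \<beta> - dpt \<alpha>"
  using assms by (simp add: dpt_def lay_translate wsum_def algebra_simps)

lemma aff_pos_translate:
  assumes "\<beta> \<in> aff_pos \<Phi> \<Delta>"
  shows "\<beta> + (0, real k) \<in> aff_pos \<Phi> \<Delta>"
  using assms by (auto simp: aff_pos_iff lay_translate aroots_def)

lemma root_le_translate:
  assumes "fst \<alpha> \<bullet> fst \<alpha> = fst \<beta> \<bullet> fst \<beta>" "\<alpha> \<in> aff_pos \<Phi> \<Delta>" "\<beta> \<in> aff_pos \<Phi> \<Delta>"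
  shows "le (\<alpha> + (0, real k)) (\<beta> + (0, real k)) \<longleftrightarrow> le \<alpha> \<beta>"
  unfolding root_le_iff dpt_translate[OF assms(1)]
  using assms(2,3) aff_pos_translate by (auto simp: word_prod_translate)

lemma poset_iso_translate:
  assumes \<O>: "\<O> \<subseteq> \<Phi>" "\<And>a. a \<in> \<O> \<Longrightarrow> - a \<in> \<O>" "\<And>a b. a \<in> \<O> \<Longrightarrow> b \<in> \<O> \<Longrightarrow> a \<bullet> a = b \<bullet> b"
  shows "poset_iso_on le (Sigma_orb \<Phi> \<Delta> \<O> k) le (Sigma_orb \<Phi> \<Delta> \<O> 0) (\<lambda>\<beta>. \<beta> - (0, real k))"
proof -
  note Sig = Sigma_orb_iff[OF \<O>(1,2)]
  have lay_diff: "lay (\<beta> - (0, real k)) = lay \<beta> - real k" for \<beta> by (simp add: lay_def)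
  have "bij_betw (\<lambda>\<beta>. \<beta> - (0, real k)) (Sigma_orb \<Phi> \<Delta> \<O> k) (Sigma_orb \<Phi> \<Delta> \<O> 0)"
    by (intro bij_betw_byWitness[where f' = "\<lambda>\<beta>. \<beta> + (0, real k)"] ballI image_subsetI)
      (simp_all add: Sig lay_diff lay_translate)
  moreover have "le \<alpha> \<beta> \<longleftrightarrow> le (\<alpha> - (0, real k)) (\<beta> - (0, real k))"
    if "\<alpha> \<in> Sigma_orb \<Phi> \<Delta> \<O> k" "\<beta> \<in> Sigma_orb \<Phi> \<Delta> \<O> k" for \<alpha> \<beta>
  proof -
    have s: "z - (0, real k) \<in> aff_pos \<Phi> \<Delta>" if "z \<in> Sigma_orb \<Phi> \<Delta> \<O> k" for z
      using calculation bij_betwE[OF calculation] that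
      by (force simp: Sigma_orb_def aff_pos_def layer_def)
    have "fst (\<alpha> - (0, real k)) \<bullet> fst (\<alpha> - (0, real k)) = fst (\<beta> - (0, real k)) \<bullet> fst (\<beta> - (0, real k))"
      using that \<O>(3) by (simp add: Sig)
    \<comment> \<open>The translation lemma moves upwards, so it is applied to the two roots already
      lowered into layer 0.\<close>
    from root_le_translate[OF this s s, of k] that show ?thesis by simp
  qed
  ultimately show ?thesis by (simp add: poset_iso_on_def)
qed

text \<open>Negation: -a is the image of \<open>a\<close> under its own reflection, covered by
  \<open>closed_under_pos_refl\<close> applied to whichever of \<open>a\<close> and
  \<open>- a\<close> is positive, since both define the same reflection. Constancy of the square
  norm is what makes translation respect the order.\<close>

lemma W0_orbit_props:
  assumes "W0_orbit \<Phi> \<Delta> \<O>"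
  shows "\<O> \<subseteq> \<Phi>" "a \<in> \<O> \<Longrightarrow> - a \<in> \<O>"
    "g \<in> \<Delta> \<Longrightarrow> a \<in> \<O> \<Longrightarrow> refl_by (\<bullet>) g a \<in> \<O>"
    "a \<in> \<O> \<Longrightarrow> b \<in> \<O> \<Longrightarrow> a \<bullet> a = b \<bullet> b"
proof -
  obtain x where x: "x \<in> \<Phi>" "\<O> = {word_prod ss x | ss. set ss \<subseteq> refl_by (\<bullet>) ` \<Delta>}"
    using assms by (auto simp: W0_orbit_def gen_group_def)
  have *: "word_prod ss x \<in> \<Phi> \<and> word_prod ss x \<bullet> word_prod ss x = x \<bullet> x"
    if "set ss \<subseteq> refl_by (\<bullet>) ` \<Delta>" for ss
    using that by (induction ss) (auto simp: x refl_root simple_in_roots inner_refl_by)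
  show sub: "\<O> \<subseteq> \<Phi>" and "a \<in> \<O> \<Longrightarrow> b \<in> \<O> \<Longrightarrow> a \<bullet> a = b \<bullet> b"
    using * x(2) by auto
  show cl: "refl_by (\<bullet>) g a \<in> \<O>" if g: "g \<in> \<Delta>" and a: "a \<in> \<O>" for g a
  proof -
    obtain ss where "a = word_prod ss x" "set ss \<subseteq> refl_by (\<bullet>) ` \<Delta>" using a x(2) by blast
    thus ?thesis using x(2) g by (auto intro!: exI[of _ "refl_by (\<bullet>) g # ss"])
  qed
  show "- a \<in> \<O>" if a: "a \<in> \<O>"
  proof (cases "pos a")
    case True
    show ?thesis
      using closed_under_pos_refl[of \<O>, OF cl _ True a] a sub refl_by_inner_self[of a] root_nonzero by force
  next
    case False
    hence "pos (- a)" "- a \<in> \<Phi>" using a sub pos_or_neg neg_root by auto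
    from closed_under_pos_refl[of \<O>, OF cl this(2,1) a] show ?thesis
      using refl_by_inner_self[of a] root_nonzero a sub by (force simp: refl_neg)
  qed
qed

end

theorem theorem4p6:
  fixes \<Phi>0 \<Delta>0 \<O> :: "'a::euclidean_space set" and \<omega> :: 'a and k :: nat
  assumes "root_system \<Phi>0" and "crystallographic \<Phi>0" and "reduced_roots \<Phi>0" and "irreducible_roots \<Phi>0"
    and "simple_system \<Phi>0 \<Delta>0"
    and "highest_root \<Phi>0 \<Delta>0 \<omega>"
    and "W0_orbit \<Phi>0 \<Delta>0 \<O>"
  shows "(\<exists>f. poset_iso_on (root_le \<Phi>0 \<Delta>0 \<omega>) (Sigma_orb \<Phi>0 \<Delta>0 \<O> k)
                            (root_le \<Phi>0 \<Delta>0 \<omega>) (Sigma_orb \<Phi>0 \<Delta>0 \<O> 0) f) \<and>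
    (\<forall>\<alpha> \<beta>. covers_on (root_le \<Phi>0 \<Delta>0 \<omega>) (Sigma_orb \<Phi>0 \<Delta>0 \<O> k) \<alpha> \<beta> \<longrightarrow>
       short_cover \<Phi>0 \<Delta>0 \<omega> \<alpha> \<beta>)"
proof -
  interpret affine_roots \<Phi>0 \<Delta>0 \<omega>
    using assms by unfold_locales
  note orb = W0_orbit_props[OF assms(7)]
  show ?thesis
    using poset_iso_translate[OF orb(1,2,4)] covers_on_orbit_layer[OF orb(1,2,3)] by blast
qed

end
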